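(* Let $U$ and $V$ be independent standard normal random variables, let $\phi\colon\mathbb{R}\to\mathbb{R}$ be Borel measurable, and let $\Gamma$ and $\Pi$ be the associated noise traders' expected loss and informed trader's conditional expected profit (defined in the context). If $\phi$ is nondecreasing and $$\Pi(V)\ge 0\qquad\text{almost surely},$$ then $\Pi(V)\in L^1$ and $$\Gamma=\mathbb{E}[\Pi(V)].$$
   Context: Set $Y=\phi(V)+U$ and let $\varrho(t)=\frac{1}{\sqrt{2\pi}}e^{-t^2/2}$. Define the continuous inverse regression $P\colon\mathbb{R}\to\mathbb{R}$ by $$P(y):=\frac{\int_{\mathbb{R}}v\,\varrho(v)\,\varrho(y-\phi(v))\,dv}{\int_{\mathbb{R}}\varrho(v)\,\varrho(y-\phi(v))\,dv},\qquad y\in\mathbb{R}.$$ It satisfies $P(Y)=\mathbb{E}[V\mid Y]$ almost surely and $P(Y)\in L^2$. Its Gaussian smoothing is $F(x):=\mathbb{E}[P(x+U)]$, $x\in\mathbb{R}$, which is finite for every $x$. The noise traders' expected loss is $$\Gamma:=\mathbb{E}\big[U\,(P(Y)-V)\big],$$ which is well defined and finite. The informed trader's conditional expected profit is $$\Pi(v):=\phi(v)\big(v-F(\phi(v))\big),\qquad v\in\mathbb{R}.$$ No integrability of $\phi(V)$ is assumed. *)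

theory Defs
  imports "HOL-Probability.Probability"
begin

text \<open>
  The density \<open>\<rho>(t) = exp (- t\<^sup>2 / 2) / sqrt (2 \<pi>)\<close> is the library's \<^const>\<open>std_normal_density\<close>.
\<close>

definition inverse_regression :: "(real \<Rightarrow> real) \<Rightarrow> real \<Rightarrow> real" where
  "inverse_regression \<phi> y =
     (\<integral>v. v * std_normal_density v * std_normal_density (y - \<phi> v) \<partial>lborel) /
     (\<integral>v. std_normal_density v * std_normal_density (y - \<phi> v) \<partial>lborel)"

definition smoothed_regression ::
    "'w measure \<Rightarrow> ('w \<Rightarrow> real) \<Rightarrow> (real \<Rightarrow> real) \<Rightarrow> real \<Rightarrow> real" where
  "smoothed_regression M U \<phi> x = (\<integral>\<omega>. inverse_regression \<phi> (x + U \<omega>) \<partial>M)"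

text \<open>The argument of \<open>inverse_regression\<close> is the order flow \<open>Y = \<phi>(V) + U\<close>.\<close>

definition noise_traders_loss ::
    "'w measure \<Rightarrow> ('w \<Rightarrow> real) \<Rightarrow> ('w \<Rightarrow> real) \<Rightarrow> (real \<Rightarrow> real) \<Rightarrow> real" where
  "noise_traders_loss M U V \<phi> =
     (\<integral>\<omega>. U \<omega> * (inverse_regression \<phi> (\<phi> (V \<omega>) + U \<omega>) - V \<omega>) \<partial>M)"

definition informed_profit ::
    "'w measure \<Rightarrow> ('w \<Rightarrow> real) \<Rightarrow> (real \<Rightarrow> real) \<Rightarrow> real \<Rightarrow> real" where
  "informed_profit M U \<phi> v = \<phi> v * (v - smoothed_regression M U \<phi> (\<phi> v))"

end

theory Submission
  imports Defs
begin

text \<open>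
  Write \<open>X = \<phi>(V)\<close>, \<open>Y = X + U\<close>, and \<open>P(Y) = E[V | Y]\<close>. If \<open>X\<close> were integrable against
  \<open>V - P(Y)\<close>, the identity would be immediate: \<open>V - P(Y)\<close> is orthogonal to every function
  of \<open>Y\<close>, so \<open>E[(X + U)(V - P(Y))] = 0\<close>, that is, \<open>\<Gamma> = E[X (V - P(Y))]\<close>; and averaging over \<open>U\<close>
  for given \<open>V\<close> replaces \<open>P(Y)\<close> by \<open>F(X)\<close>.

  In general let \<open>c\<^sub>n\<close> clamp a number to \<open>[-n, n]\<close>. The bounded random variables \<open>c\<^sub>n(X)\<close> and
  \<open>c\<^sub>n(Y)\<close> are covered by the argument above, since \<open>V\<close> and \<open>P(Y)\<close> are square integrable:
  orthogonality (lemma \<open>regression_orthogonal\<close>) and averaging over \<open>U\<close>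
  (lemma \<open>expectation_smoothed_regression\<close>) give
  \<open>E[c\<^sub>n(X) (V - F(X))] = E[(c\<^sub>n(X) - c\<^sub>n(Y)) (V - P(Y))]\<close>.
  Both sides have limits, for different reasons. On the right the two truncations cancel up to
  an integrable error: \<open>c\<^sub>n\<close> is a contraction, so \<open>|c\<^sub>n(X) - c\<^sub>n(Y)| \<le> |U|\<close>, and dominated
  convergence yields \<open>E[-U (V - P(Y))] = \<Gamma>\<close>. On the left \<open>c\<^sub>n\<close> preserves signs and
  \<open>|c\<^sub>n(X)|\<close> increases to \<open>|X|\<close>, so where \<open>\<Pi>(V) = X (V - F(X)) \<ge> 0\<close> the integrand increases
  to \<open>\<Pi>(V)\<close>. As the integrals converge to the finite number \<open>\<Gamma>\<close>, monotone convergence gives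
  the integrability of \<open>\<Pi>(V)\<close> and the identity together.
\<close>

section \<open>The regression function and its conditional moments\<close>

lemma std_normal_density_le_1: "std_normal_density x \<le> 1"
proof -
  have "1 \<le> sqrt (2 * pi)"
    using pi_ge_two by (simp add: real_le_rsqrt)
  then show ?thesis
    by (auto simp: std_normal_density_def divide_le_eq_1 intro: order_trans[of _ 1])
qed

text \<open>
  This is the joint density of \<open>(Y, V)\<close> at \<open>(y, v)\<close>. Numerator and denominator of
  \<open>inverse_regression \<phi> y\<close> are its first and zeroth moments in \<open>v\<close>.
\<close>

abbreviation order_flow_density :: "(real \<Rightarrow> real) \<Rightarrow> real \<Rightarrow> real \<Rightarrow> real" where
  "order_flow_density \<phi> y v \<equiv> std_normal_density v * std_normal_density (y - \<phi> v)"

lemma integrable_order_flow_moment: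
  assumes [measurable]: "\<phi> \<in> borel_measurable borel"
  shows "integrable lborel (\<lambda>v. v ^ k * order_flow_density \<phi> y v)"
proof (rule Bochner_Integration.integrable_bound)
  show "integrable lborel (\<lambda>v. std_normal_density v * v ^ k)"
    by (rule integrable_std_normal_moment)
  show "AE v in lborel. norm (v ^ k * order_flow_density \<phi> y v) \<le> norm (std_normal_density v * v ^ k)"
    using std_normal_density_le_1 by (auto simp: abs_mult mult_ac intro!: mult_left_mono mult_left_le)
qed measurable

lemma order_flow_marginal_pos:
  assumes "\<phi> \<in> borel_measurable borel"
  shows "(\<integral>v. order_flow_density \<phi> y v \<partial>lborel) > 0"
proof -
  have int: "integrable lborel (order_flow_density \<phi> y)"
    using integrable_order_flow_moment[OF assms, of 0] by simp
  have "(\<integral>v. order_flow_density \<phi> y v \<partial>lborel) \<noteq> 0"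
  proof
    assume "(\<integral>v. order_flow_density \<phi> y v \<partial>lborel) = 0"
    then have "AE v in lborel. order_flow_density \<phi> y v = 0"
      using integral_nonneg_eq_0_iff_AE[OF int] by simp
    moreover have "order_flow_density \<phi> y v \<noteq> 0" for v
      by (metis less_irrefl mult_pos_pos normal_density_pos zero_less_one)
    ultimately have "AE v::real in lborel. False"
      by (simp only:)
    then show False
      by (simp add: AE_iff_measurable[where N = UNIV])
  qed
  then show ?thesis
    by (simp add: less_le)
qed

lemma borel_measurable_inverse_regression [measurable]:
  assumes [measurable]: "\<phi> \<in> borel_measurable borel"
  shows "inverse_regression \<phi> \<in> borel_measurable borel"
  unfolding inverse_regression_def by measurable

lemma inverse_regression_moment:
  assumes "\<phi> \<in> borel_measurable borel"
  shows "inverse_regression \<phi> y * (\<integral>v. order_flow_density \<phi> y v \<partial>lborel)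
    = (\<integral>v. v * order_flow_density \<phi> y v \<partial>lborel)"
  using order_flow_marginal_pos[OF assms, of y] by (simp add: inverse_regression_def mult.assoc)

text \<open>
  Conditional form of \<open>E[V | Y]\<^sup>2 \<le> E[V\<^sup>2 | Y]\<close>, obtained from the nonnegativity of the
  conditional variance \<open>E[(V - P(y))\<^sup>2 | Y = y]\<close>. All terms are multiplied by the marginal
  density of \<open>Y\<close>, so that integrating over \<open>y\<close> bounds \<open>E[P(Y)\<^sup>2]\<close> by \<open>E[V\<^sup>2]\<close>.
\<close>

lemma inverse_regression_square_le:
  assumes "\<phi> \<in> borel_measurable borel"
  shows "(inverse_regression \<phi> y)\<^sup>2 * (\<integral>v. order_flow_density \<phi> y v \<partial>lborel)
    \<le> (\<integral>v. v\<^sup>2 * order_flow_density \<phi> y v \<partial>lborel)"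
proof -
  let ?w = "order_flow_density \<phi> y" and ?p = "inverse_regression \<phi> y"
  note int = integrable_order_flow_moment[OF assms, of _ y]
  have i0: "integrable lborel ?w" and i1: "integrable lborel (\<lambda>v. v * ?w v)"
    and i2: "integrable lborel (\<lambda>v. v\<^sup>2 * ?w v)"
    using int[of 0] int[of 1] int[of 2] by simp_all
  have "0 \<le> (\<integral>v. (v - ?p)\<^sup>2 * ?w v \<partial>lborel)"
    by (intro integral_nonneg_AE) simp
  also have "\<dots> = (\<integral>v. v\<^sup>2 * ?w v - 2 * ?p * (v * ?w v) + ?p\<^sup>2 * ?w v \<partial>lborel)"
    by (intro Bochner_Integration.integral_cong) (auto simp: power2_eq_square algebra_simps)
  also have "\<dots> = (\<integral>v. v\<^sup>2 * ?w v \<partial>lborel) - 2 * ?p * (\<integral>v. v * ?w v \<partial>lborel)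
      + ?p\<^sup>2 * (\<integral>v. ?w v \<partial>lborel)"
    using i0 i1 i2 by simp
  also have "\<dots> = (\<integral>v. v\<^sup>2 * ?w v \<partial>lborel) - ?p\<^sup>2 * (\<integral>v. ?w v \<partial>lborel)"
    by (simp add: inverse_regression_moment[OF assms, symmetric] power2_eq_square)
  finally show ?thesis by simp
qed

section \<open>Laws of the order flow and orthogonality\<close>

locale gaussian_market = prob_space M
  for M :: "'w measure" +
  fixes U V :: "'w \<Rightarrow> real" and \<phi> :: "real \<Rightarrow> real"
  assumes distributed_U: "distributed M lborel U std_normal_density"
    and distributed_V: "distributed M lborel V std_normal_density"
    and indep_U_V: "indep_var borel U borel V"
    and measurable_strategy [measurable]: "\<phi> \<in> borel_measurable borel"
begin

abbreviation X where "X \<omega> \<equiv> \<phi> (V \<omega>)"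
abbreviation Y where "Y \<omega> \<equiv> X \<omega> + U \<omega>"
abbreviation P where "P \<equiv> inverse_regression \<phi>"
abbreviation F where "F \<equiv> smoothed_regression M U \<phi>"

lemma measurable_U [measurable]: "U \<in> borel_measurable M"
  and measurable_V [measurable]: "V \<in> borel_measurable M"
  using distributed_measurable[OF distributed_U] distributed_measurable[OF distributed_V] by simp_all

lemma distributed_U_V:
  "distributed M (lborel \<Otimes>\<^sub>M lborel) (\<lambda>\<omega>. (U \<omega>, V \<omega>))
    (\<lambda>(u, v). ennreal (std_normal_density u * std_normal_density v))"
proof -
  have "indep_var lborel U lborel V"
    using indep_U_V by (simp add: indep_var_eq)
  from distributed_joint_indep[OF _ _ distributed_U distributed_V this]
  show ?thesis
    by (simp add: lborel.sigma_finite_measure_axioms ennreal_mult)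
qed

text \<open>
  For fixed \<open>v\<close> the map from \<open>u\<close> to \<open>y = \<phi> v + u\<close> is a translation, which preserves Lebesgue
  measure; the density of \<open>(U, V)\<close> therefore only has to be rewritten in the new coordinates.
\<close>

lemma distributed_order_flow_value:
  "distributed M (lborel \<Otimes>\<^sub>M lborel) (\<lambda>\<omega>. (Y \<omega>, V \<omega>))
    (\<lambda>(y, v). ennreal (order_flow_density \<phi> y v))"
  unfolding distributed_def
proof (intro conjI measure_eqI)
  let ?d = "density (lborel \<Otimes>\<^sub>M lborel) (\<lambda>(y, v). ennreal (order_flow_density \<phi> y v))"
  let ?d' = "distr M (lborel \<Otimes>\<^sub>M lborel) (\<lambda>\<omega>. (Y \<omega>, V \<omega>))"
  fix A assume "A \<in> sets ?d'"
  then have A [measurable]: "A \<in> sets (borel \<Otimes>\<^sub>M borel)" by (simp cong: sets_pair_measure_cong)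
  have "emeasure ?d' A = (\<integral>\<^sup>+\<omega>. indicator A (Y \<omega>, V \<omega>) \<partial>M)"
    by (subst nn_integral_indicator[symmetric], simp, subst nn_integral_distr)
      (auto simp: \<open>A \<in> sets ?d'\<close>)
  also have "\<dots> = (\<integral>\<^sup>+z. (case z of (u, v) \<Rightarrow> ennreal (std_normal_density u * std_normal_density v))
      * (case z of (u, v) \<Rightarrow> indicator A (\<phi> v + u, v)) \<partial>(lborel \<Otimes>\<^sub>M lborel))"
    by (subst distributed_nn_integral[OF distributed_U_V]) auto
  also have "\<dots> = (\<integral>\<^sup>+v. \<integral>\<^sup>+u. ennreal (std_normal_density u * std_normal_density v)
      * indicator A (\<phi> v + u, v) \<partial>lborel \<partial>lborel)"
    by (subst lborel_pair.nn_integral_snd[symmetric]) auto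
  also have "\<dots> = (\<integral>\<^sup>+v. \<integral>\<^sup>+y. ennreal (order_flow_density \<phi> y v) * indicator A (y, v) \<partial>lborel \<partial>lborel)"
  proof (rule nn_integral_cong)
    fix v :: real
    show "(\<integral>\<^sup>+u. ennreal (std_normal_density u * std_normal_density v) * indicator A (\<phi> v + u, v) \<partial>lborel)
      = (\<integral>\<^sup>+y. ennreal (order_flow_density \<phi> y v) * indicator A (y, v) \<partial>lborel)"
      by (subst (2) nn_integral_real_affine[where c = 1 and t = "\<phi> v"]) (auto simp: mult.commute)
  qed
  also have "\<dots> = (\<integral>\<^sup>+z. (case z of (y, v) \<Rightarrow> ennreal (order_flow_density \<phi> y v)) * indicator A z
      \<partial>(lborel \<Otimes>\<^sub>M lborel))"
    by (subst lborel_pair.nn_integral_snd[symmetric]) auto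
  also have "\<dots> = emeasure ?d A"
    by (subst emeasure_density) (auto simp: \<open>A \<in> sets ?d'\<close>[simplified])
  finally show "emeasure ?d' A = emeasure ?d A" .
qed auto

lemma integrable_V_square: "integrable M (\<lambda>\<omega>. (V \<omega>)\<^sup>2)"
  using distributed_integrable[OF distributed_V, of "\<lambda>v. v\<^sup>2"] integrable_std_normal_moment[of 2]
  by simp

lemma integrable_U_square: "integrable M (\<lambda>\<omega>. (U \<omega>)\<^sup>2)"
  using distributed_integrable[OF distributed_U, of "\<lambda>v. v\<^sup>2"] integrable_std_normal_moment[of 2]
  by simp

lemma nn_integral_order_flow_value:
  assumes [measurable]: "case_prod h \<in> borel_measurable (borel \<Otimes>\<^sub>M borel)"
  shows "(\<integral>\<^sup>+\<omega>. h (Y \<omega>) (V \<omega>) \<partial>M)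
    = (\<integral>\<^sup>+y. \<integral>\<^sup>+v. ennreal (order_flow_density \<phi> y v) * h y v \<partial>lborel \<partial>lborel)"
proof -
  have "(\<integral>\<^sup>+\<omega>. h (Y \<omega>) (V \<omega>) \<partial>M)
    = (\<integral>\<^sup>+z. (case z of (y, v) \<Rightarrow> ennreal (order_flow_density \<phi> y v)) * case_prod h z
        \<partial>(lborel \<Otimes>\<^sub>M lborel))"
    by (subst distributed_nn_integral[OF distributed_order_flow_value]) auto
  also have "\<dots> = (\<integral>\<^sup>+y. \<integral>\<^sup>+v. ennreal (order_flow_density \<phi> y v) * h y v \<partial>lborel \<partial>lborel)"
    by (subst lborel.nn_integral_fst[symmetric]) auto
  finally show ?thesis .
qed

lemma integrable_regression_square: "integrable M (\<lambda>\<omega>. (P (Y \<omega>))\<^sup>2)"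
proof (rule integrableI_bounded)
  let ?w = "order_flow_density \<phi>"
  have "(\<integral>\<^sup>+\<omega>. ennreal (norm ((P (Y \<omega>))\<^sup>2)) \<partial>M)
    = (\<integral>\<^sup>+y. \<integral>\<^sup>+v. ennreal (?w y v) * ennreal ((P y)\<^sup>2) \<partial>lborel \<partial>lborel)"
    using nn_integral_order_flow_value[of "\<lambda>y v. ennreal ((P y)\<^sup>2)"] by simp
  also have "\<dots> \<le> (\<integral>\<^sup>+y. \<integral>\<^sup>+v. ennreal (?w y v) * ennreal (v\<^sup>2) \<partial>lborel \<partial>lborel)"
  proof (rule nn_integral_mono)
    fix y :: real
    have i0: "integrable lborel (?w y)" and i2: "integrable lborel (\<lambda>v. v\<^sup>2 * ?w y v)"
      using integrable_order_flow_moment[OF measurable_strategy, of 0 y]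
        integrable_order_flow_moment[OF measurable_strategy, of 2 y] by simp_all
    have "(\<integral>\<^sup>+v. ennreal (?w y v) * ennreal ((P y)\<^sup>2) \<partial>lborel)
      = ennreal ((\<integral>v. ?w y v \<partial>lborel) * (P y)\<^sup>2)"
      using i0 by (subst nn_integral_multc) (simp_all add: nn_integral_eq_integral flip: ennreal_mult)
    also have "\<dots> \<le> ennreal (\<integral>v. v\<^sup>2 * ?w y v \<partial>lborel)"
      using inverse_regression_square_le[OF measurable_strategy, of y]
      by (intro ennreal_leI) (simp add: mult.commute)
    also have "\<dots> = (\<integral>\<^sup>+v. ennreal (v\<^sup>2 * ?w y v) \<partial>lborel)"
      using i2 by (simp add: nn_integral_eq_integral)
    also have "\<dots> = (\<integral>\<^sup>+v. ennreal (?w y v) * ennreal (v\<^sup>2) \<partial>lborel)"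
      by (intro nn_integral_cong) (simp add: ennreal_mult[symmetric] mult.commute)
    finally show "(\<integral>\<^sup>+v. ennreal (?w y v) * ennreal ((P y)\<^sup>2) \<partial>lborel)
      \<le> (\<integral>\<^sup>+v. ennreal (?w y v) * ennreal (v\<^sup>2) \<partial>lborel)" .
  qed
  also have "\<dots> = (\<integral>\<^sup>+\<omega>. ennreal ((V \<omega>)\<^sup>2) \<partial>M)"
    using nn_integral_order_flow_value[of "\<lambda>y v. ennreal (v\<^sup>2)"] by simp
  also have "\<dots> < \<infinity>"
    using integrable_V_square by (simp add: nn_integral_eq_integral)
  finally show "(\<integral>\<^sup>+\<omega>. ennreal (norm ((P (Y \<omega>))\<^sup>2)) \<partial>M) < \<infinity>" .
qed measurable

lemma integrable_bounded_mult:
  assumes [measurable]: "f \<in> borel_measurable M" "Z \<in> borel_measurable M"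
    and "\<And>\<omega>. \<bar>f \<omega>\<bar> \<le> c" "integrable M (\<lambda>\<omega>. (Z \<omega>)\<^sup>2)"
  shows "integrable M (\<lambda>\<omega>. f \<omega> * Z \<omega> :: real)"
proof -
  have "integrable M Z"
    by (rule square_integrable_imp_integrable) (fact assms)+
  then have "integrable M (\<lambda>\<omega>. c * Z \<omega>)"
    by simp
  then show ?thesis
  proof (rule Bochner_Integration.integrable_bound)
    show "AE \<omega> in M. norm (f \<omega> * Z \<omega>) \<le> norm (c * Z \<omega>)"
    proof (rule AE_I2)
      fix \<omega>
      have "\<bar>f \<omega>\<bar> \<le> \<bar>c\<bar>"
        using assms(3)[of \<omega>] by linarith
      then show "norm (f \<omega> * Z \<omega>) \<le> norm (c * Z \<omega>)"
        by (simp add: abs_mult mult_right_mono)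
    qed
  qed measurable
qed

text \<open>
  The defining property of \<open>P(Y) = E[V | Y]\<close>, for bounded test functions. Integrating first over
  \<open>v\<close> at fixed \<open>y\<close> leaves the first moment minus \<open>P(y)\<close> times the zeroth moment, which is zero
  by definition of \<open>P\<close>.
\<close>

lemma regression_orthogonal:
  fixes g :: "real \<Rightarrow> real"
  assumes [measurable]: "g \<in> borel_measurable borel" and bounded: "\<And>y. \<bar>g y\<bar> \<le> c"
  shows "expectation (\<lambda>\<omega>. g (Y \<omega>) * (V \<omega> - P (Y \<omega>))) = 0"
proof -
  let ?w = "order_flow_density \<phi>"
  let ?f = "\<lambda>(y, v). ?w y v * (g y * (v - P y))"
  have "integrable M (\<lambda>\<omega>. g (Y \<omega>) * V \<omega> - g (Y \<omega>) * P (Y \<omega>))"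
    using bounded integrable_V_square integrable_regression_square
    by (intro Bochner_Integration.integrable_diff integrable_bounded_mult[where c = c]) auto
  then have "integrable M (\<lambda>\<omega>. g (Y \<omega>) * (V \<omega> - P (Y \<omega>)))"
    by (simp add: right_diff_distrib)
  then have int: "integrable (lborel \<Otimes>\<^sub>M lborel) ?f"
    using distributed_integrable[OF distributed_order_flow_value[unfolded case_prod_beta'],
        of "\<lambda>(y, v). g y * (v - P y)"]
    by (simp add: case_prod_beta')
  have "expectation (\<lambda>\<omega>. g (Y \<omega>) * (V \<omega> - P (Y \<omega>))) = integral\<^sup>L (lborel \<Otimes>\<^sub>M lborel) ?f"
    using distributed_integral[OF distributed_order_flow_value[unfolded case_prod_beta'],
        of "\<lambda>(y, v). g y * (v - P y)"]
    by (simp add: case_prod_beta')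
  also have "\<dots> = (\<integral>y. \<integral>v. ?w y v * (g y * (v - P y)) \<partial>lborel \<partial>lborel)"
    using lborel_pair.integral_fst'[OF int] by simp
  also have "\<dots> = (\<integral>y. 0 \<partial>(lborel :: real measure))"
  proof (rule Bochner_Integration.integral_cong)
    fix y :: real
    have i0: "integrable lborel (?w y)" and i1: "integrable lborel (\<lambda>v. v * ?w y v)"
      using integrable_order_flow_moment[OF measurable_strategy, of 0 y]
        integrable_order_flow_moment[OF measurable_strategy, of 1 y] by simp_all
    have "(\<integral>v. ?w y v * (g y * (v - P y)) \<partial>lborel)
      = (\<integral>v. g y * (v * ?w y v - P y * ?w y v) \<partial>lborel)"
      by (intro Bochner_Integration.integral_cong) (auto simp: algebra_simps)
    also have "\<dots> = g y * ((\<integral>v. v * ?w y v \<partial>lborel) - P y * (\<integral>v. ?w y v \<partial>lborel))"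
      using i0 i1 by (simp del: mult_cancel_left)
    also have "\<dots> = 0"
      by (simp add: inverse_regression_moment[OF measurable_strategy])
    finally show "(\<integral>v. ?w y v * (g y * (v - P y)) \<partial>lborel) = 0" .
  qed simp
  finally show ?thesis by simp
qed

lemma smoothed_regression_eq: "F x = (\<integral>u. std_normal_density u * P (x + u) \<partial>lborel)"
  unfolding smoothed_regression_def
  by (subst distributed_integral[OF distributed_U, symmetric]) auto

lemma measurable_smoothed_regression [measurable]: "F \<in> borel_measurable borel"
  unfolding smoothed_regression_eq by measurable

text \<open>
  Averaging over \<open>U\<close> at fixed \<open>V\<close>. Boundedness of \<open>a\<close> and square integrability of \<open>P(Y)\<close> make
  \<open>a(V) P(Y)\<close> integrable, and Fubini's theorem carries this over to \<open>a(V) F(X)\<close>.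
\<close>

lemma
  fixes a :: "real \<Rightarrow> real"
  assumes [measurable]: "a \<in> borel_measurable borel" and bounded: "\<And>v. \<bar>a v\<bar> \<le> c"
  shows integrable_smoothed_regression: "integrable M (\<lambda>\<omega>. a (V \<omega>) * F (X \<omega>))"
    and expectation_smoothed_regression:
      "expectation (\<lambda>\<omega>. a (V \<omega>) * P (Y \<omega>)) = expectation (\<lambda>\<omega>. a (V \<omega>) * F (X \<omega>))"
proof -
  let ?\<rho> = std_normal_density
  let ?f = "\<lambda>u v. (?\<rho> u * ?\<rho> v) * (a v * P (\<phi> v + u))"
  have "integrable M (\<lambda>\<omega>. a (V \<omega>) * P (Y \<omega>))"
    using bounded integrable_regression_square by (intro integrable_bounded_mult[where c = c]) auto
  then have int: "integrable (lborel \<Otimes>\<^sub>M lborel) (case_prod ?f)"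
    using distributed_integrable[OF distributed_U_V[unfolded case_prod_beta'],
        of "\<lambda>(u, v). a v * P (\<phi> v + u)"]
    by (simp add: case_prod_beta')
  have inner: "(\<integral>u. ?f u v \<partial>lborel) = ?\<rho> v * (a v * F (\<phi> v))" for v
  proof -
    have "(\<integral>u. ?f u v \<partial>lborel) = (\<integral>u. (?\<rho> v * a v) * (?\<rho> u * P (\<phi> v + u)) \<partial>lborel)"
      by (intro Bochner_Integration.integral_cong) (auto simp: mult_ac)
    then show ?thesis
      by (simp only: integral_mult_right_zero smoothed_regression_eq mult.assoc)
  qed
  have "integrable lborel (\<lambda>v. ?\<rho> v * (a v * F (\<phi> v)))"
    using lborel_pair.integrable_snd[OF int] by (simp only: inner)
  then show "integrable M (\<lambda>\<omega>. a (V \<omega>) * F (X \<omega>))"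
    using distributed_integrable[OF distributed_V, of "\<lambda>v. a v * F (\<phi> v)"] by simp
  have "expectation (\<lambda>\<omega>. a (V \<omega>) * P (Y \<omega>)) = integral\<^sup>L (lborel \<Otimes>\<^sub>M lborel) (case_prod ?f)"
    using distributed_integral[OF distributed_U_V[unfolded case_prod_beta'],
        of "\<lambda>(u, v). a v * P (\<phi> v + u)"]
    by (simp add: case_prod_beta')
  also have "\<dots> = (\<integral>v. ?\<rho> v * (a v * F (\<phi> v)) \<partial>lborel)"
    using lborel_pair.integral_snd[OF int] by (simp only: inner)
  also have "\<dots> = expectation (\<lambda>\<omega>. a (V \<omega>) * F (X \<omega>))"
    by (subst distributed_integral[OF distributed_V]) auto
  finally show "expectation (\<lambda>\<omega>. a (V \<omega>) * P (Y \<omega>)) = expectation (\<lambda>\<omega>. a (V \<omega>) * F (X \<omega>))" .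
qed

end

section \<open>Truncation\<close>

text \<open>
  Clamping is used in place of the cut-off \<open>x 1\<^bsub>{|x| \<le> n}\<^esub>\<close> because it is a contraction.
\<close>

definition clamp_at :: "nat \<Rightarrow> real \<Rightarrow> real" where
  "clamp_at n x = max (- real n) (min (real n) x)"

lemma measurable_clamp_at [measurable]: "clamp_at n \<in> borel_measurable borel"
  unfolding clamp_at_def by measurable

lemma abs_clamp_at_le: "\<bar>clamp_at n x\<bar> \<le> real n"
  by (auto simp: clamp_at_def)

lemma clamp_at_lipschitz: "\<bar>clamp_at n x - clamp_at n y\<bar> \<le> \<bar>x - y\<bar>"
  by (auto simp: clamp_at_def max_def min_def)

lemma clamp_at_tendsto: "(\<lambda>n. clamp_at n x) \<longlonglongrightarrow> x"
proof (rule tendsto_eventually)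
  obtain N where N: "\<bar>x\<bar> \<le> real N"
    using real_arch_simple by blast
  show "eventually (\<lambda>n. clamp_at n x = x) sequentially"
    using eventually_ge_at_top[of N]
  proof eventually_elim
    case (elim n)
    then have "\<bar>x\<bar> \<le> real n" using N by linarith
    then show ?case by (auto simp: clamp_at_def)
  qed
qed

lemma mono_clamp_at_mult:
  assumes "0 \<le> x * z"
  shows "mono (\<lambda>n. clamp_at n x * z)"
proof (rule monoI)
  fix m n :: nat assume "m \<le> n"
  then have mn: "real m \<le> real n"
    by simp
  consider "z = 0" | "0 < z" "0 \<le> x" | "z < 0" "x \<le> 0"
    using assms by (cases z "0 :: real" rule: linorder_cases) (auto simp: zero_le_mult_iff)
  then show "clamp_at m x * z \<le> clamp_at n x * z"
  proof cases
    case 2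
    then have "clamp_at m x \<le> clamp_at n x"
      using mn by (auto simp: clamp_at_def)
    then show ?thesis
      using 2 by (simp add: mult_right_mono)
  next
    case 3
    then have "clamp_at n x \<le> clamp_at m x"
      using mn by (auto simp: clamp_at_def)
    then show ?thesis
      using 3 by (simp add: mult_right_mono_neg)
  qed simp
qed

section \<open>Passing to the limit\<close>

context gaussian_market
begin

text \<open>
  Subtracting \<open>c\<^sub>n(Y)\<close> costs nothing by orthogonality, and it is what makes the right-hand
  integrand dominated uniformly in \<open>n\<close>.
\<close>

lemma expectation_clamped_profit:
  "integrable M (\<lambda>\<omega>. clamp_at n (X \<omega>) * (V \<omega> - F (X \<omega>)))"
  "expectation (\<lambda>\<omega>. clamp_at n (X \<omega>) * (V \<omega> - F (X \<omega>)))
    = expectation (\<lambda>\<omega>. (clamp_at n (X \<omega>) - clamp_at n (Y \<omega>)) * (V \<omega> - P (Y \<omega>)))"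
proof -
  note sq = integrable_V_square integrable_regression_square
  let ?x = "\<lambda>\<omega>. clamp_at n (X \<omega>)" and ?y = "\<lambda>\<omega>. clamp_at n (Y \<omega>)"
  have xV: "integrable M (\<lambda>\<omega>. ?x \<omega> * V \<omega>)" and xP: "integrable M (\<lambda>\<omega>. ?x \<omega> * P (Y \<omega>))"
    and yV: "integrable M (\<lambda>\<omega>. ?y \<omega> * V \<omega>)" and yP: "integrable M (\<lambda>\<omega>. ?y \<omega> * P (Y \<omega>))"
    using sq by (auto intro!: integrable_bounded_mult[where c = n] abs_clamp_at_le)
  have xF: "integrable M (\<lambda>\<omega>. ?x \<omega> * F (X \<omega>))"
    by (rule integrable_smoothed_regression[where a = "\<lambda>v. clamp_at n (\<phi> v)" and c = n])
      (auto intro: abs_clamp_at_le)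
  show "integrable M (\<lambda>\<omega>. ?x \<omega> * (V \<omega> - F (X \<omega>)))"
    using xV xF by (simp add: right_diff_distrib)
  have "expectation (\<lambda>\<omega>. ?x \<omega> * P (Y \<omega>)) = expectation (\<lambda>\<omega>. ?x \<omega> * F (X \<omega>))"
    by (rule expectation_smoothed_regression[where a = "\<lambda>v. clamp_at n (\<phi> v)" and c = n])
      (auto intro: abs_clamp_at_le)
  moreover have "expectation (\<lambda>\<omega>. ?y \<omega> * (V \<omega> - P (Y \<omega>))) = 0"
    by (rule regression_orthogonal[where c = n]) (auto intro: abs_clamp_at_le)
  ultimately show "expectation (\<lambda>\<omega>. ?x \<omega> * (V \<omega> - F (X \<omega>)))
      = expectation (\<lambda>\<omega>. (?x \<omega> - ?y \<omega>) * (V \<omega> - P (Y \<omega>)))"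
    using xV xP yV yP xF by (simp add: algebra_simps)
qed

lemma expectation_clamped_profit_tendsto:
  "(\<lambda>n. expectation (\<lambda>\<omega>. clamp_at n (X \<omega>) * (V \<omega> - F (X \<omega>)))) \<longlonglongrightarrow> noise_traders_loss M U V \<phi>"
  unfolding expectation_clamped_profit(2) noise_traders_loss_def
proof (rule integral_dominated_convergence)
  let ?r = "\<lambda>\<omega>. V \<omega> - P (Y \<omega>)"
  show "integrable M (\<lambda>\<omega>. (U \<omega>)\<^sup>2 + 2 * (V \<omega>)\<^sup>2 + 2 * (P (Y \<omega>))\<^sup>2)"
    using integrable_U_square integrable_V_square integrable_regression_square by auto
  show "AE \<omega> in M. norm ((clamp_at n (X \<omega>) - clamp_at n (Y \<omega>)) * ?r \<omega>)
      \<le> (U \<omega>)\<^sup>2 + 2 * (V \<omega>)\<^sup>2 + 2 * (P (Y \<omega>))\<^sup>2" for n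
  proof (rule AE_I2)
    fix \<omega>
    have young: "\<bar>u\<bar> * \<bar>v - p\<bar> \<le> u\<^sup>2 + 2 * v\<^sup>2 + 2 * p\<^sup>2" for u v p :: real
    proof -
      have "0 \<le> (\<bar>u\<bar> - \<bar>v - p\<bar>)\<^sup>2" "0 \<le> (v + p)\<^sup>2" "0 \<le> u\<^sup>2" "0 \<le> v\<^sup>2" "0 \<le> p\<^sup>2"
        by simp_all
      then have "2 * (\<bar>u\<bar> * \<bar>v - p\<bar>) \<le> u\<^sup>2 + (v - p)\<^sup>2" "(v - p)\<^sup>2 \<le> 2 * v\<^sup>2 + 2 * p\<^sup>2"
        by (simp_all add: power2_eq_square algebra_simps flip: abs_mult)
      then show ?thesis
        using \<open>0 \<le> u\<^sup>2\<close> \<open>0 \<le> v\<^sup>2\<close> \<open>0 \<le> p\<^sup>2\<close> by linarith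
    qed
    have "norm ((clamp_at n (X \<omega>) - clamp_at n (Y \<omega>)) * ?r \<omega>) \<le> \<bar>U \<omega>\<bar> * \<bar>?r \<omega>\<bar>"
      using clamp_at_lipschitz[of n "X \<omega>" "Y \<omega>"] by (auto simp: abs_mult intro!: mult_right_mono)
    then show "norm ((clamp_at n (X \<omega>) - clamp_at n (Y \<omega>)) * ?r \<omega>)
      \<le> (U \<omega>)\<^sup>2 + 2 * (V \<omega>)\<^sup>2 + 2 * (P (Y \<omega>))\<^sup>2"
      using young[of "U \<omega>" "V \<omega>" "P (Y \<omega>)"] by linarith
  qed
  show "AE \<omega> in M. (\<lambda>n. (clamp_at n (X \<omega>) - clamp_at n (Y \<omega>)) * ?r \<omega>)
      \<longlonglongrightarrow> U \<omega> * (P (Y \<omega>) - V \<omega>)"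
  proof (rule AE_I2)
    fix \<omega>
    have "(\<lambda>n. (clamp_at n (X \<omega>) - clamp_at n (Y \<omega>)) * ?r \<omega>) \<longlonglongrightarrow> (X \<omega> - Y \<omega>) * ?r \<omega>"
      by (intro tendsto_intros clamp_at_tendsto)
    then show "(\<lambda>n. (clamp_at n (X \<omega>) - clamp_at n (Y \<omega>)) * ?r \<omega>) \<longlonglongrightarrow> U \<omega> * (P (Y \<omega>) - V \<omega>)"
      by (simp add: algebra_simps)
  qed
qed measurable

end

theorem proposition5p1:
  fixes M :: "'w measure" and U V :: "'w \<Rightarrow> real" and \<phi> :: "real \<Rightarrow> real"
  assumes "prob_space M"
    and "distributed M lborel U std_normal_density"
    and "distributed M lborel V std_normal_density"
    and "prob_space.indep_var M borel U borel V"
    and "\<phi> \<in> borel_measurable borel"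
    and "mono \<phi>"
    and "AE \<omega> in M. informed_profit M U \<phi> (V \<omega>) \<ge> 0"
  shows "integrable M (\<lambda>\<omega>. informed_profit M U \<phi> (V \<omega>)) \<and>
    noise_traders_loss M U V \<phi> = (\<integral>\<omega>. informed_profit M U \<phi> (V \<omega>) \<partial>M)"
proof -
  interpret gaussian_market M U V \<phi>
    using assms by (simp add: gaussian_market_def gaussian_market_axioms_def)
  let ?f = "\<lambda>n \<omega>. clamp_at n (X \<omega>) * (V \<omega> - F (X \<omega>))"
  have mono: "AE \<omega> in M. mono (\<lambda>n. ?f n \<omega>)"
    using assms(7) by eventually_elim (rule mono_clamp_at_mult, simp add: informed_profit_def)
  have lim: "AE \<omega> in M. (\<lambda>n. ?f n \<omega>) \<longlonglongrightarrow> informed_profit M U \<phi> (V \<omega>)"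
    unfolding informed_profit_def by (intro AE_I2 tendsto_intros clamp_at_tendsto)
  have meas: "(\<lambda>\<omega>. informed_profit M U \<phi> (V \<omega>)) \<in> borel_measurable M"
    unfolding informed_profit_def by measurable
  note conv = expectation_clamped_profit(1) mono lim expectation_clamped_profit_tendsto meas
  show ?thesis
    using integrable_monotone_convergence[OF conv] integral_monotone_convergence[OF conv] by simp
qed

end
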